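(* Let $p$ be a prime, $s>0$, and let $F\subset\mathbb{Z}_p$ be a nonempty closed set with $\mathcal{H}^s(F)<\infty$. Assume that there is an $\mathcal{H}^s$-integrable function $g$ on $F$ such that, for $\mathcal{H}^s$-almost all $x\in F$, $\eta_s(F;x,n)\le g(x)$ for all $n\in\mathbb{N}$. Define $$\underline{\theta}^s_{*}(F)=\limsup_{n\to\infty}\ \min_{a\in G_n}\frac{\mathcal{H}^s(F\cap B_{p^{-n}}(a))}{p^{-ns}}\in[0,+\infty],$$ where $G_n=\{a\in\mathbb{Z}/p^n\mathbb{Z}: B_{p^{-n}}(a)\cap F\ne\emptyset\}$. Then $$\underline{\theta}^s_{*}(F)\,\mathcal{H}_s(F\cap\mathbb{Z})\le\int_F\eta_s(F;x)\,d\mathcal{H}^s(x)$$ (with the convention $0\cdot\infty=0$). Moreover, if $F$ is $s$-Ahlfors-David regular, then $0<\underline{\theta}^s_{*}(F)<+\infty$.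
   Context: $\mathbb{Z}_p$ is the ring of $p$-adic integers with metric $|x-y|_p$, and $B_r(x)=\{y\in\mathbb{Z}_p:|x-y|_p\le r\}$; for $a\in\mathbb{Z}/p^n\mathbb{Z}$ the ball $B_{p^{-n}}(a)$ is well defined. $I$ always denotes an interval of integers $(M,N]=\{M+1,\dots,N\}\subset\mathbb{Z}$ with $|I|=N-M$, $|A|$ is the cardinality of a finite set $A$, and $\limsup_{|I|\to\infty}f(I)=\lim_{L\to\infty}\sup\{f(I):|I|\ge L\}$ over all intervals. The $s$-counting measure of $E\subset\mathbb{Z}$ is $\mathcal{H}_s(E)=\limsup_{|I|\to\infty}\frac{|E\cap I|}{|I|^s}\in[0,\infty]$. For $F\subset\mathbb{Z}_p$, $x\in\mathbb{Z}_p$, $n\in\mathbb{N}$: $\eta_s(F;x,n)=\limsup_{|I|\to\infty}\frac{|F\cap B_{p^{-n}}(x)\cap I|}{|B_{p^{-n}}(x)\cap I|^s}$ and $\eta_s(F;x)=\limsup_{n\to\infty}\eta_s(F;x,n)$. $\mathcal{H}^s$ is the $s$-dimensional Hausdorff measure on $\mathbb{Z}_p$: $\mathcal{H}^s(F)=\lim_{\delta\to0}\inf\{\sum_i r_i^s\}$, the infimum being over countable covers of $F$ by balls $B_{r_i}(a_i)$ with $r_i<\delta$. A closed set $F\subset\mathbb{Z}_p$ is $s$-Ahlfors-David regular if there is a constant $C>0$ such that $C^{-1}\le\mathcal{H}^s(F\cap B_r(x))/r^s\le C$ for every $x\in F$ and every $0<r\le1$. *)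

theory Defs
  imports "HOL-Analysis.Analysis"
begin

section \<open>The $p$-adic integers\<close>

text \<open>
  The ring of $p$-adic integers is the inverse limit of the rings of integers modulo $p^n$. An
  element \<open>x\<close> is stored as its sequence of residues, \<open>x n\<close> being the representative in
  \<open>{0..<p ^ n}\<close> of \<open>x\<close> modulo $p^n$. Since \<open>p\<close> varies, this is a carrier set and not a type.
\<close>

type_synonym padic = "nat \<Rightarrow> int"

definition Zp :: "nat \<Rightarrow> padic set" where
  "Zp p = {x. \<forall>n. 0 \<le> x n \<and> x n < int p ^ n \<and> x (Suc n) mod int p ^ n = x n}"

definition zp_of_int :: "nat \<Rightarrow> int \<Rightarrow> padic" where
  "zp_of_int p k = (\<lambda>n. k mod int p ^ n)"

definition zp_diff :: "nat \<Rightarrow> padic \<Rightarrow> padic \<Rightarrow> padic" where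
  "zp_diff p x y = (\<lambda>n. (x n - y n) mod int p ^ n)"

text \<open>For \<open>x \<in> Zp p\<close>, \<open>x n = 0\<close> means that $p^n$ divides \<open>x\<close>.\<close>

definition zp_val :: "padic \<Rightarrow> nat" where
  "zp_val x = Max {n. x n = 0}"

definition zp_abs :: "nat \<Rightarrow> padic \<Rightarrow> real" where
  "zp_abs p x = (if x = (\<lambda>n. 0) then 0 else 1 / real p ^ zp_val x)"

definition zp_dist :: "nat \<Rightarrow> padic \<Rightarrow> padic \<Rightarrow> real" where
  "zp_dist p x y = zp_abs p (zp_diff p x y)"

abbreviation zp_ball :: "nat \<Rightarrow> padic \<Rightarrow> real \<Rightarrow> padic set" where
  "zp_ball p \<equiv> Metric_space.mcball (Zp p) (zp_dist p)"

abbreviation zp_topology :: "nat \<Rightarrow> padic topology" where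
  "zp_topology p \<equiv> Metric_space.mtopology (Zp p) (zp_dist p)"


subsection \<open>The metric space axioms\<close>

lemma zp_of_int_in_Zp:
  assumes "prime p"
  shows "zp_of_int p k \<in> Zp p"
  using prime_gt_0_nat[OF assms]
  by (auto simp: Zp_def zp_of_int_def mod_mod_cancel)

lemma Zp_mod:
  assumes "x \<in> Zp p" "m \<le> n"
  shows "x n mod int p ^ m = x m"
  using assms(2)
proof (induction n rule: dec_induct)
  case base
  then show ?case using assms(1) by (simp add: Zp_def)
next
  case (step n)
  have "x (Suc n) mod int p ^ m = x (Suc n) mod int p ^ n mod int p ^ m"
    using step.hyps by (simp add: mod_mod_cancel le_imp_power_dvd)
  also have "\<dots> = x n mod int p ^ m"
    using assms(1) by (simp add: Zp_def)
  finally show ?case using step.IH by simp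
qed

lemma zp_diff_eq_0_iff:
  assumes "x \<in> Zp p" "y \<in> Zp p"
  shows "zp_diff p x y n = 0 \<longleftrightarrow> x n = y n"
proof -
  have "x n mod int p ^ n = x n" "y n mod int p ^ n = y n"
    using assms by (auto simp: Zp_mod)
  then show ?thesis
    unfolding zp_diff_def using mod_eq_dvd_iff[of "x n" "int p ^ n" "y n"]
    by (simp add: dvd_eq_mod_eq_0)
qed

lemma zp_dist_le_iff:
  assumes "prime p" "x \<in> Zp p" "y \<in> Zp p"
  shows "zp_dist p x y \<le> 1 / real p ^ n \<longleftrightarrow> x n = y n"
proof (cases "x = y")
  case True
  then show ?thesis using prime_gt_0_nat[OF assms(1)]
    by (simp add: zp_dist_def zp_abs_def zp_diff_def)
next
  case False
  let ?S = "{k. x k = y k}"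
  have S: "{k. zp_diff p x y k = 0} = ?S"
    using zp_diff_eq_0_iff[OF assms(2,3)] by simp
  obtain N where N: "x N \<noteq> y N" using False by (auto simp: fun_eq_iff)
  have down: "x m = y m" if "x k = y k" "m \<le> k" for m k
    using Zp_mod[OF assms(2) that(2)] Zp_mod[OF assms(3) that(2)] that(1) by simp
  have bd: "?S \<subseteq> {..<N}" using down N by (auto simp: not_less[symmetric])
  have fin: "finite ?S" using bd finite_subset by blast
  have z0: "z 0 = 0" if "z \<in> Zp p" for z
  proof -
    have "0 \<le> z 0 \<and> z 0 < int p ^ 0" using that unfolding Zp_def by blast
    then show ?thesis by simp
  qed
  have "x 0 = y 0" using z0[OF assms(2)] z0[OF assms(3)] by simp
  then have ne: "?S \<noteq> {}" by blast
  have v: "n \<le> Max ?S \<longleftrightarrow> x n = y n"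
  proof
    assume "n \<le> Max ?S"
    then show "x n = y n" using down[of "Max ?S" n] Max_in[OF fin ne] by blast
  next
    assume "x n = y n"
    then show "n \<le> Max ?S" by (intro Max_ge[OF fin]) simp
  qed
  have "zp_diff p x y \<noteq> (\<lambda>n. 0)" using N zp_diff_eq_0_iff[OF assms(2,3), of N] by auto
  then have "zp_dist p x y = 1 / real p ^ Max ?S"
    by (simp add: zp_dist_def zp_abs_def zp_val_def S)
  moreover have "1 < real p" using prime_gt_1_nat[OF assms(1)] by simp
  then have "1 / real p ^ Max ?S \<le> 1 / real p ^ n \<longleftrightarrow> n \<le> Max ?S"
    by (simp add: divide_simps)
  ultimately show ?thesis using v by simp
qed

lemma zp_dist_cases:
  obtains "zp_dist p x y = 0" | n where "zp_dist p x y = 1 / real p ^ n"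
  unfolding zp_dist_def zp_abs_def by metis

lemma zp_dist_eq_0_iff:
  assumes "prime p" "x \<in> Zp p" "y \<in> Zp p"
  shows "zp_dist p x y = 0 \<longleftrightarrow> x = y"
proof
  assume "zp_dist p x y = 0"
  then have "x n = y n" for n
    using zp_dist_le_iff[OF assms, of n] by simp
  then show "x = y" by auto
qed (simp add: zp_dist_def zp_abs_def zp_diff_def)

lemma zp_dist_ultrametric:
  assumes "prime p" "x \<in> Zp p" "y \<in> Zp p" "z \<in> Zp p"
  shows "zp_dist p x z \<le> max (zp_dist p x y) (zp_dist p y z)"
proof -
  let ?m = "max (zp_dist p x y) (zp_dist p y z)"
  have le: "zp_dist p x z \<le> 1 / real p ^ n" if "?m \<le> 1 / real p ^ n" for n
    using that zp_dist_le_iff[OF assms(1)] assms by auto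
  consider "?m = 0" | n where "?m = 1 / real p ^ n"
    by (metis max_def zp_dist_cases)
  then show ?thesis
  proof cases
    case 1
    moreover have "0 \<le> zp_dist p x y" "0 \<le> zp_dist p y z"
      by (simp_all add: zp_dist_def zp_abs_def)
    ultimately have "zp_dist p x y = 0" "zp_dist p y z = 0" by linarith+
    then show ?thesis using assms zp_dist_eq_0_iff by force
  next
    case 2
    then show ?thesis using le by simp
  qed
qed

lemma Metric_space_Zp:
  assumes "prime p"
  shows "Metric_space (Zp p) (zp_dist p)"
proof
  fix x y :: padic
  show nonneg: "0 \<le> zp_dist p x y" for x y by (simp add: zp_dist_def zp_abs_def)
  show "zp_dist p x y = zp_dist p y x"
  proof -
    have "zp_diff p x y n = 0 \<longleftrightarrow> zp_diff p y x n = 0" for n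
      unfolding zp_diff_def by (metis dvd_eq_mod_eq_0 dvd_diff_commute)
    then show ?thesis
      by (simp add: zp_dist_def zp_abs_def zp_val_def fun_eq_iff)
  qed
  show "zp_dist p x y = 0 \<longleftrightarrow> x = y" if "x \<in> Zp p" "y \<in> Zp p"
    using zp_dist_eq_0_iff[OF assms that] .
  show "zp_dist p x z \<le> zp_dist p x y + zp_dist p y z"
    if "x \<in> Zp p" "y \<in> Zp p" "z \<in> Zp p" for z
    using zp_dist_ultrametric[OF assms that] nonneg[of x y] nonneg[of y z] by linarith
qed


section \<open>Hausdorff measure\<close>

text \<open>
  A countable cover is a family of balls indexed by a set \<open>J\<close> of natural numbers, so that finite
  covers (and the empty cover of the empty set) are included.
\<close>

definition hausdorff_pre :: "nat \<Rightarrow> real \<Rightarrow> real \<Rightarrow> padic set \<Rightarrow> ennreal" where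
  "hausdorff_pre p s \<delta> F =
     Inf {\<Sum>\<^sub>\<infinity>i\<in>J. ennreal (r i powr s) | (J :: nat set) (a :: nat \<Rightarrow> padic) (r :: nat \<Rightarrow> real).
            (\<forall>i\<in>J. a i \<in> Zp p \<and> 0 < r i \<and> r i < \<delta>) \<and> F \<subseteq> (\<Union>i\<in>J. zp_ball p (a i) (r i))}"

definition hausdorff :: "nat \<Rightarrow> real \<Rightarrow> padic set \<Rightarrow> ennreal" where
  "hausdorff p s F = Lim (at_right 0) (\<lambda>\<delta>. hausdorff_pre p s \<delta> F)"

text \<open>
  For integration, the outer measure is restricted to its Caratheodory measurable sets.
\<close>

definition hausdorff_measure :: "nat \<Rightarrow> real \<Rightarrow> padic measure" where
  "hausdorff_measure p s =
     measure_of (Zp p) (lambda_system (Zp p) (Pow (Zp p)) (hausdorff p s)) (hausdorff p s)"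

definition ahlfors_david_regular :: "nat \<Rightarrow> real \<Rightarrow> padic set \<Rightarrow> bool" where
  "ahlfors_david_regular p s F \<longleftrightarrow>
     closedin (zp_topology p) F \<and>
     (\<exists>C>0. \<forall>x\<in>F. \<forall>r. 0 < r \<and> r \<le> 1 \<longrightarrow>
        ennreal (1 / C) \<le> hausdorff p s (F \<inter> zp_ball p x r) / ennreal (r powr s) \<and>
        hausdorff p s (F \<inter> zp_ball p x r) / ennreal (r powr s) \<le> ennreal C)"


section \<open>Counting measures and densities\<close>

definition interval_limsup :: "(int set \<Rightarrow> ennreal) \<Rightarrow> ennreal" where
  "interval_limsup f =
     lim (\<lambda>L::nat. Sup {f I | I. (\<exists>M N. I = {M<..N}) \<and> L \<le> card I})"

definition counting_measure :: "real \<Rightarrow> int set \<Rightarrow> ennreal" where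
  "counting_measure s E =
     interval_limsup (\<lambda>I. ennreal (real (card (E \<inter> I)) / real (card I) powr s))"

definition zp_ints :: "nat \<Rightarrow> padic set \<Rightarrow> int set" where
  "zp_ints p F = {k. zp_of_int p k \<in> F}"

text \<open>
  In the next ratio the denominator vanishes only for short intervals, which do not affect the limit.
\<close>

definition eta_n :: "nat \<Rightarrow> real \<Rightarrow> padic set \<Rightarrow> padic \<Rightarrow> nat \<Rightarrow> ennreal" where
  "eta_n p s F x n =
     interval_limsup (\<lambda>I.
       ennreal (real (card (zp_ints p (F \<inter> zp_ball p x (1 / real p ^ n)) \<inter> I))
                / real (card (zp_ints p (zp_ball p x (1 / real p ^ n)) \<inter> I)) powr s))"

definition eta :: "nat \<Rightarrow> real \<Rightarrow> padic set \<Rightarrow> padic \<Rightarrow> ennreal" where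
  "eta p s F x = limsup (\<lambda>n. eta_n p s F x n)"

text \<open>Classes modulo $p^n$ are given by their representatives in \<open>{0..<p ^ n}\<close>.\<close>

definition residue_ball :: "nat \<Rightarrow> nat \<Rightarrow> int \<Rightarrow> padic set" where
  "residue_ball p n a = zp_ball p (zp_of_int p a) (1 / real p ^ n)"

definition residue_classes :: "nat \<Rightarrow> padic set \<Rightarrow> nat \<Rightarrow> int set" where
  "residue_classes p F n = {a \<in> {0..<int p ^ n}. residue_ball p n a \<inter> F \<noteq> {}}"

definition lower_theta :: "nat \<Rightarrow> real \<Rightarrow> padic set \<Rightarrow> ennreal" where
  "lower_theta p s F =
     limsup (\<lambda>n. Min ((\<lambda>a. hausdorff p s (F \<inter> residue_ball p n a)
                             / ennreal (real p powr (- (real n * s)))) ` residue_classes p F n))"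

end

theory Submission
  imports Defs
begin

text \<open>
  The function \<open>\<eta>\<^sub>s(F; \<cdot>, n)\<close> is constant on balls of radius \<open>p\<^sup>-\<^sup>n\<close>. Splitting \<open>F \<inter> I\<close> along the
  residue classes modulo \<open>p ^ n\<close>, each of which meets a long interval \<open>I\<close> in about \<open>|I| / p ^ n\<close>
  points, bounds the counting measure of \<open>F\<close> by the sum of \<open>p powr (- n s) * \<eta>\<^sub>s(F; a, n)\<close> over the
  classes \<open>a\<close> that meet \<open>F\<close>. Multiplied by the minimum in \<open>lower_theta\<close>, the weight of the class \<open>a\<close> is
  at most the Hausdorff measure of \<open>F\<close> in that class, so the sum is at most the integral of
  \<open>\<eta>\<^sub>s(F; \<cdot>, n)\<close> over \<open>F\<close>. The reverse Fatou lemma with majorant \<open>g\<close> gives the limit in \<open>n\<close>.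
\<close>

section \<open>The Hausdorff outer measure\<close>

lemma hausdorff_pre_le:
  assumes "\<And>i. i \<in> J \<Longrightarrow> a i \<in> Zp p \<and> 0 < r i \<and> r i < \<delta>"
    and "F \<subseteq> (\<Union>i\<in>J. zp_ball p (a i) (r i))"
  shows "hausdorff_pre p s \<delta> F \<le> (\<Sum>\<^sub>\<infinity>i\<in>(J :: nat set). ennreal (r i powr s))"
  unfolding hausdorff_pre_def
  by (rule Inf_lower, rule CollectI, rule exI[of _ J], rule exI[of _ a], rule exI[of _ r])
     (use assms in auto)

lemma hausdorff_pre_greatest:
  assumes "\<And>J a r. (\<And>i. i \<in> J \<Longrightarrow> a i \<in> Zp p \<and> 0 < r i \<and> r i < \<delta>) \<Longrightarrow>
      F \<subseteq> (\<Union>i\<in>J. zp_ball p (a i) (r i)) \<Longrightarrow> z \<le> (\<Sum>\<^sub>\<infinity>i\<in>(J::nat set). ennreal (r i powr s))"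
  shows "z \<le> hausdorff_pre p s \<delta> F"
  unfolding hausdorff_pre_def
proof (rule Inf_greatest, elim CollectE exE conjE)
  fix u J a r
  assume "u = (\<Sum>\<^sub>\<infinity>i\<in>(J::nat set). ennreal (r i powr s))"
    "\<forall>i\<in>J. a i \<in> Zp p \<and> 0 < r i \<and> r i < \<delta>" "F \<subseteq> (\<Union>i\<in>J. zp_ball p (a i) (r i))"
  then show "z \<le> u" using assms[of J a r] by simp
qed

lemma hausdorff_pre_antimono: "\<delta> \<le> \<epsilon> \<Longrightarrow> hausdorff_pre p s \<epsilon> F \<le> hausdorff_pre p s \<delta> F"
  by (rule hausdorff_pre_greatest, rule hausdorff_pre_le) force+

lemma hausdorff_pre_mono: "A \<subseteq> B \<Longrightarrow> hausdorff_pre p s \<delta> A \<le> hausdorff_pre p s \<delta> B"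
  by (rule hausdorff_pre_greatest, rule hausdorff_pre_le) auto

lemma hausdorff_pre_empty [simp]: "hausdorff_pre p s \<delta> {} = 0"
  using hausdorff_pre_le[of "{}" "\<lambda>_. undefined" p "\<lambda>_. 0" \<delta> "{}" s] by simp

text \<open>Shrinking \<open>\<delta>\<close> leaves fewer admissible covers, so the infimum grows
  and its one-sided limit at 0 exists in \<open>ennreal\<close> as a supremum. Later bounds only
  have to be checked at each fixed scale.\<close>

lemma hausdorff_eq_SUP: "hausdorff p s F = (SUP \<delta>\<in>{0<..}. hausdorff_pre p s \<delta> F)"
  unfolding hausdorff_def
proof (intro tendsto_Lim order_tendstoI)
  fix a assume "a < (SUP \<delta>\<in>{0<..}. hausdorff_pre p s \<delta> F)"
  then obtain e where e: "0 < e" "a < hausdorff_pre p s e F" by (auto simp: less_SUP_iff)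
  have "a < hausdorff_pre p s \<delta> F" if "\<delta> < e" for \<delta>
    using e that hausdorff_pre_antimono[of \<delta> e p s F] by (meson less_le_trans less_imp_le)
  then show "\<forall>\<^sub>F \<delta> in at_right 0. a < hausdorff_pre p s \<delta> F"
    using e(1) by (auto simp: eventually_at_right_field)
next
  fix a assume a: "(SUP \<delta>\<in>{0<..}. hausdorff_pre p s \<delta> F) < a"
  have "hausdorff_pre p s \<delta> F < a" if "0 < \<delta>" for \<delta>
    using a that by (meson SUP_lessD greaterThan_iff)
  then show "\<forall>\<^sub>F \<delta> in at_right 0. hausdorff_pre p s \<delta> F < a"
    by (auto simp: eventually_at_right_field intro: exI[of _ 1])
qed simp

lemma hausdorff_pre_le_hausdorff: "0 < \<delta> \<Longrightarrow> hausdorff_pre p s \<delta> F \<le> hausdorff p s F"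
  unfolding hausdorff_eq_SUP by (rule SUP_upper) simp

lemma hausdorff_le:
  assumes "\<And>\<delta>. 0 < \<delta> \<Longrightarrow> hausdorff_pre p s \<delta> F \<le> z"
  shows "hausdorff p s F \<le> z"
  unfolding hausdorff_eq_SUP using assms by (intro SUP_least) simp

lemma hausdorff_mono: "A \<subseteq> B \<Longrightarrow> hausdorff p s A \<le> hausdorff p s B"
  unfolding hausdorff_eq_SUP by (intro SUP_mono) (use hausdorff_pre_mono in blast)

lemma hausdorff_empty [simp]: "hausdorff p s {} = 0"
  by (simp add: hausdorff_eq_SUP)

section \<open>Countable subadditivity at a fixed scale\<close>

lemma sum_le_infsum_ennreal:
  fixes f :: "'a \<Rightarrow> ennreal"
  assumes "finite G" "G \<subseteq> A"
  shows "sum f G \<le> infsum f A"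
  by (subst nonneg_infsum_complete) (use assms in \<open>auto intro: SUP_upper\<close>)

text \<open>A finite partial sum meets only finitely many fibres of \<open>h\<close>, and within
  each of them it is bounded by the sum over the full fibre. This bounds the cost of a cover
  assembled from countably many covers.\<close>

lemma infsum_fibres_le_suminf_ennreal:
  fixes f :: "'a \<Rightarrow> ennreal" and h :: "'a \<Rightarrow> nat"
  shows "infsum f K \<le> (\<Sum>i. infsum f {k \<in> K. h k = i})"
proof (subst nonneg_infsum_complete, simp, rule SUP_least)
  fix G assume "G \<in> {G. finite G \<and> G \<subseteq> K}"
  then have G: "finite G" "G \<subseteq> K" by auto
  have "sum f G = (\<Sum>i\<in>h ` G. sum f {k \<in> G. h k = i})"
    by (rule sum.image_gen[OF G(1)])
  also have "\<dots> \<le> (\<Sum>i\<in>h ` G. infsum f {k \<in> K. h k = i})"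
    using G by (intro sum_mono sum_le_infsum_ennreal) auto
  also have "\<dots> \<le> (\<Sum>i. infsum f {k \<in> K. h k = i})"
    using G by (intro sum_le_suminf) auto
  finally show "sum f G \<le> (\<Sum>i. infsum f {k \<in> K. h k = i})" .
qed

lemma hausdorff_pre_UN_le:
  "hausdorff_pre p s \<delta> (\<Union>i. A i) \<le> (\<Sum>i::nat. hausdorff_pre p s \<delta> (A i))"
proof (rule ennreal_le_epsilon)
  fix e :: real
  assume e: "0 < e" and fin: "(\<Sum>i. hausdorff_pre p s \<delta> (A i)) < top"
  \<comment> \<open>A nearly optimal cover of each \<open>A n\<close>; the allowed excesses
    \<open>e * (1/2) ^ Suc n\<close> add up to \<open>e\<close>. If no such cover existed, the
    infimum would exceed itself by a positive amount, which is impossible because finiteness of the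
    series makes it finite.\<close>
  have "\<exists>J a r. (\<forall>i\<in>J. a i \<in> Zp p \<and> 0 < r i \<and> r i < \<delta>)
      \<and> A n \<subseteq> (\<Union>i\<in>J. zp_ball p (a i) (r i))
      \<and> (\<Sum>\<^sub>\<infinity>i\<in>(J::nat set). ennreal (r i powr s)) \<le> hausdorff_pre p s \<delta> (A n) + ennreal (e * (1/2) ^ Suc n)" for n
  proof (rule ccontr)
    assume none: "\<not> ?thesis"
    have "hausdorff_pre p s \<delta> (A n) + ennreal (e * (1/2) ^ Suc n) \<le> hausdorff_pre p s \<delta> (A n)"
      by (rule hausdorff_pre_greatest) (use none in \<open>meson linear\<close>)
    moreover have "hausdorff_pre p s \<delta> (A n) < top"
      using ennreal_suminf_lessD[OF fin, of n] .
    moreover have "0 < ennreal (e * (1/2) ^ Suc n)" using e by simp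
    ultimately show False
      by (metis ennreal_add_left_cancel_le add.right_neutral leD infinity_ennreal_def less_irrefl)
  qed
  then have "\<forall>n. \<exists>J a r. (\<forall>i\<in>J. a i \<in> Zp p \<and> 0 < r i \<and> r i < \<delta>)
      \<and> A n \<subseteq> (\<Union>i\<in>J. zp_ball p (a i) (r i))
      \<and> (\<Sum>\<^sub>\<infinity>i\<in>(J::nat set). ennreal (r i powr s)) \<le> hausdorff_pre p s \<delta> (A n) + ennreal (e * (1/2) ^ Suc n)"
    by (rule allI)
  from choice[OF this] obtain J where "\<forall>n. \<exists>a r. (\<forall>i\<in>J n. a i \<in> Zp p \<and> 0 < r i \<and> r i < \<delta>)
      \<and> A n \<subseteq> (\<Union>i\<in>J n. zp_ball p (a i) (r i))
      \<and> (\<Sum>\<^sub>\<infinity>i\<in>(J n::nat set). ennreal (r i powr s)) \<le> hausdorff_pre p s \<delta> (A n) + ennreal (e * (1/2) ^ Suc n)" ..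
  from choice[OF this] obtain a where "\<forall>n. \<exists>r. (\<forall>i\<in>J n. a n i \<in> Zp p \<and> 0 < r i \<and> r i < \<delta>)
      \<and> A n \<subseteq> (\<Union>i\<in>J n. zp_ball p (a n i) (r i))
      \<and> (\<Sum>\<^sub>\<infinity>i\<in>J n. ennreal (r i powr s)) \<le> hausdorff_pre p s \<delta> (A n) + ennreal (e * (1/2) ^ Suc n)" ..
  from choice[OF this] obtain r where
    cov: "\<And>n i. i \<in> J n \<Longrightarrow> a n i \<in> Zp p \<and> 0 < r n i \<and> r n i < \<delta>"
      "\<And>n. A n \<subseteq> (\<Union>i\<in>J n. zp_ball p (a n i) (r n i))"
    and le: "\<And>n. (\<Sum>\<^sub>\<infinity>i\<in>(J n::nat set). ennreal (r n i powr s))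
        \<le> hausdorff_pre p s \<delta> (A n) + ennreal (e * (1/2) ^ Suc n)"
    by blast
  \<comment> \<open>The pairing function merges the chosen covers into one family indexed by
    naturals: \<open>h k\<close> says which set is being covered and \<open>q k\<close> is the index
    within its cover.\<close>
  define h where "h k = fst (prod_decode k)" for k
  define q where "q k = snd (prod_decode k)" for k
  define K where "K = {k. q k \<in> J (h k)}"
  define f where "f k = ennreal (r (h k) (q k) powr s)" for k
  have K: "h (prod_encode (n, i)) = n" "q (prod_encode (n, i)) = i" for n i
    by (auto simp: h_def q_def)
  have "hausdorff_pre p s \<delta> (\<Union>i. A i) \<le> infsum f K"
    unfolding f_def
  proof (rule hausdorff_pre_le[where a = "\<lambda>k. a (h k) (q k)"])
    show "a (h k) (q k) \<in> Zp p \<and> 0 < r (h k) (q k) \<and> r (h k) (q k) < \<delta>" if "k \<in> K" for k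
      using that cov(1) by (simp add: K_def)
    show "(\<Union>i. A i) \<subseteq> (\<Union>k\<in>K. zp_ball p (a (h k) (q k)) (r (h k) (q k)))"
    proof safe
      fix x n assume "x \<in> A n"
      then obtain i where "i \<in> J n" "x \<in> zp_ball p (a n i) (r n i)" using cov(2) by blast
      then show "x \<in> (\<Union>k\<in>K. zp_ball p (a (h k) (q k)) (r (h k) (q k)))"
        by (intro UN_I[of "prod_encode (n, i)"]) (simp_all add: K K_def)
    qed
  qed
  also have "\<dots> \<le> (\<Sum>n. infsum f {k \<in> K. h k = n})"
    by (rule infsum_fibres_le_suminf_ennreal)
  also have "\<dots> \<le> (\<Sum>n. hausdorff_pre p s \<delta> (A n) + ennreal (e * (1/2) ^ Suc n))"
  proof (intro suminf_le)
    fix n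
    have inj: "inj_on (\<lambda>i. prod_encode (n, i)) (J n)" by (auto simp: inj_on_def)
    have img: "{k \<in> K. h k = n} = (\<lambda>i. prod_encode (n, i)) ` J n"
      by (auto simp: K_def h_def q_def image_iff)
        (metis prod.collapse prod_decode_inverse)
    show "infsum f {k \<in> K. h k = n} \<le> hausdorff_pre p s \<delta> (A n) + ennreal (e * (1/2) ^ Suc n)"
      using le[of n] unfolding img infsum_reindex[OF inj] by (simp add: f_def o_def K)
  qed simp_all
  also have "\<dots> = (\<Sum>n. hausdorff_pre p s \<delta> (A n)) + (\<Sum>n. ennreal (e * (1/2) ^ Suc n))"
    by (subst suminf_add) auto
  also have "(\<Sum>n. ennreal (e * (1/2) ^ Suc n)) = ennreal e"
    using e sums_mult[OF power_half_series, of e]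
    by (intro sums_unique[symmetric]) (simp add: sums_ennreal)
  finally show "hausdorff_pre p s \<delta> (\<Union>i. A i) \<le> (\<Sum>i. hausdorff_pre p s \<delta> (A i)) + ennreal e" .
qed

section \<open>Caratheodory's construction for the Hausdorff outer measure\<close>

lemma outer_measure_space_hausdorff: "outer_measure_space (Pow (Zp p)) (hausdorff p s)"
  unfolding outer_measure_space_def
proof (intro conjI)
  show "positive (Pow (Zp p)) (hausdorff p s)" by (simp add: positive_def)
  show "increasing (Pow (Zp p)) (hausdorff p s)" by (simp add: increasing_def hausdorff_mono)
  \<comment> \<open>Subadditivity holds at every scale, and each term there is at most the limit
    value; the resulting bound is independent of \<open>\<delta>\<close>, so it survives the
    supremum.\<close>
  have "hausdorff p s (\<Union>i. A i) \<le> (\<Sum>i::nat. hausdorff p s (A i))" for A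
    by (rule hausdorff_le, rule order_trans[OF hausdorff_pre_UN_le])
       (intro suminf_le hausdorff_pre_le_hausdorff; simp)
  then show "countably_subadditive (Pow (Zp p)) (hausdorff p s)"
    by (simp add: countably_subadditive_def)
qed

text \<open>Caratheodory's lemma makes the lambda system a sigma-algebra on which
  \<open>hausdorff\<close> is a measure. This ensures that \<open>measure_of\<close> neither
  enlarges the family of sets nor falls back to the zero measure.\<close>

lemma
  shows space_hausdorff_measure [simp]: "space (hausdorff_measure p s) = Zp p"
    and sets_hausdorff_measure:
      "sets (hausdorff_measure p s) = lambda_system (Zp p) (Pow (Zp p)) (hausdorff p s)"
    and emeasure_hausdorff_measure:
      "A \<in> sets (hausdorff_measure p s) \<Longrightarrow> emeasure (hausdorff_measure p s) A = hausdorff p s A"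
proof -
  let ?L = "lambda_system (Zp p) (Pow (Zp p)) (hausdorff p s)"
  have ms: "measure_space (Zp p) ?L (hausdorff p s)"
    using sigma_algebra.caratheodory_lemma[OF sigma_algebra_Pow outer_measure_space_hausdorff] .
  then have L: "sigma_algebra (Zp p) ?L" by (simp add: measure_space_def)
  show "space (hausdorff_measure p s) = Zp p"
    unfolding hausdorff_measure_def using sigma_algebra.space_measure_of_eq[OF L] .
  show sets: "sets (hausdorff_measure p s) = ?L"
    unfolding hausdorff_measure_def using sigma_algebra.sets_measure_of_eq[OF L] .
  show "emeasure (hausdorff_measure p s) A = hausdorff p s A"
    if "A \<in> sets (hausdorff_measure p s)"
    using that ms unfolding sets unfolding hausdorff_measure_def
    by (intro emeasure_measure_of_sigma) (auto simp: measure_space_def)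
qed

lemma mem_zp_ball_iff:
  assumes "prime p"
  shows "y \<in> zp_ball p x (1 / real p ^ n) \<longleftrightarrow> x \<in> Zp p \<and> y \<in> Zp p \<and> y n = x n"
  using Metric_space.in_mcball[OF Metric_space_Zp[OF assms]] zp_dist_le_iff[OF assms, of x y n]
  by auto

text \<open>Covers by balls of radius below \<open>1 / p ^ n\<close> therefore split along a ball of radius
  \<open>1 / p ^ n\<close>, which makes the latter Caratheodory measurable.\<close>

lemma zp_ball_subset_or_disjoint:
  assumes "prime p" and "r \<le> 1 / real p ^ n"
  shows "zp_ball p a r \<subseteq> zp_ball p x (1 / real p ^ n) \<or> zp_ball p a r \<inter> zp_ball p x (1 / real p ^ n) = {}"
proof -
  have "y n = z n" if "y \<in> zp_ball p a r" "z \<in> zp_ball p a r" for y z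
  proof -
    have "y \<in> zp_ball p a (1 / real p ^ n)" "z \<in> zp_ball p a (1 / real p ^ n)"
      using that assms by (auto simp: Metric_space.in_mcball[OF Metric_space_Zp])
    then show ?thesis using assms by (simp add: mem_zp_ball_iff)
  qed
  moreover have "zp_ball p a r \<subseteq> Zp p"
    by (auto simp: Metric_space.in_mcball[OF Metric_space_Zp[OF assms(1)]])
  ultimately show ?thesis
    unfolding subset_iff disjoint_iff mem_zp_ball_iff[OF assms(1)] by metis
qed

lemma zp_ball_in_sets:
  assumes "prime p"
  shows "zp_ball p x (1 / real p ^ n) \<in> sets (hausdorff_measure p s)"
proof -
  let ?B = "zp_ball p x (1 / real p ^ n)"
  have BZ: "?B \<subseteq> Zp p" using mem_zp_ball_iff[OF assms] by auto
  have split: "hausdorff_pre p s \<delta> (?B \<inter> E) + hausdorff_pre p s \<delta> ((Zp p - ?B) \<inter> E)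
      \<le> hausdorff_pre p s \<delta> E" if \<delta>: "\<delta> \<le> 1 / real p ^ n" for \<delta> E
  proof (rule hausdorff_pre_greatest)
    fix J :: "nat set" and a r
    assume J: "\<And>i. i \<in> J \<Longrightarrow> a i \<in> Zp p \<and> 0 < r i \<and> r i < \<delta>"
      and E: "E \<subseteq> (\<Union>i\<in>J. zp_ball p (a i) (r i))"
    \<comment> \<open>At scales up to \<open>1 / p ^ n\<close> every ball of the cover lies inside
      \<open>?B\<close> or misses it. The first kind covers the part of \<open>E\<close> in
      \<open>?B\<close>, the second the part outside, and no ball is paid for twice.\<close>
    let ?J1 = "{i\<in>J. zp_ball p (a i) (r i) \<subseteq> ?B}"
    let ?J2 = "{i\<in>J. \<not> zp_ball p (a i) (r i) \<subseteq> ?B}"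
    have dis: "zp_ball p (a i) (r i) \<inter> ?B = {}" if "i \<in> ?J2" for i
      using that J \<delta> zp_ball_subset_or_disjoint[OF assms, of "r i" n "a i" x]
      by (smt (verit) mem_Collect_eq)
    have "hausdorff_pre p s \<delta> (?B \<inter> E) \<le> (\<Sum>\<^sub>\<infinity>i\<in>?J1. ennreal (r i powr s))"
    proof (rule hausdorff_pre_le)
      show "?B \<inter> E \<subseteq> (\<Union>i\<in>?J1. zp_ball p (a i) (r i))"
      proof
        fix y assume y: "y \<in> ?B \<inter> E"
        then obtain i where i: "i \<in> J" "y \<in> zp_ball p (a i) (r i)" using E by blast
        then have "i \<in> ?J1" using dis[of i] y by blast
        then show "y \<in> (\<Union>i\<in>?J1. zp_ball p (a i) (r i))" using i by blast
      qed
    qed (use J in blast)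
    moreover have "hausdorff_pre p s \<delta> ((Zp p - ?B) \<inter> E) \<le> (\<Sum>\<^sub>\<infinity>i\<in>?J2. ennreal (r i powr s))"
      by (rule hausdorff_pre_le) (use J E in \<open>blast+\<close>)
    moreover have "(\<Sum>\<^sub>\<infinity>i\<in>?J1. ennreal (r i powr s)) + (\<Sum>\<^sub>\<infinity>i\<in>?J2. ennreal (r i powr s))
        = (\<Sum>\<^sub>\<infinity>i\<in>?J1 \<union> ?J2. ennreal (r i powr s))"
      by (intro infsum_Un_disjoint[symmetric] nonneg_summable_on_complete) auto
    moreover have "?J1 \<union> ?J2 = J" by blast
    ultimately show "hausdorff_pre p s \<delta> (?B \<inter> E) + hausdorff_pre p s \<delta> ((Zp p - ?B) \<inter> E)
        \<le> (\<Sum>\<^sub>\<infinity>i\<in>J. ennreal (r i powr s))"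
      by (metis (no_types, lifting) add_mono)
  qed
  have le: "hausdorff p s (?B \<inter> E) + hausdorff p s ((Zp p - ?B) \<inter> E) \<le> hausdorff p s E" for E
  proof -
    have pos: "0 < 1 / real p ^ n" using prime_gt_0_nat[OF assms] by simp
    \<comment> \<open>Two independent scales allow the suprema to be taken one after the other.
      Passing to a common smaller scale \<open>m\<close> below \<open>1 / p ^ n\<close> only
      increases both terms and makes \<open>split\<close> applicable.\<close>
    have "hausdorff_pre p s \<delta> (?B \<inter> E) + hausdorff_pre p s \<epsilon> ((Zp p - ?B) \<inter> E) \<le> hausdorff p s E"
      if "0 < \<delta>" "0 < \<epsilon>" for \<delta> \<epsilon>
    proof -
      define m where "m = min (min \<delta> \<epsilon>) (1 / real p ^ n)"
      have m: "0 < m" "m \<le> \<delta>" "m \<le> \<epsilon>" "m \<le> 1 / real p ^ n" using that pos by (auto simp: m_def)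
      have "hausdorff_pre p s \<delta> (?B \<inter> E) + hausdorff_pre p s \<epsilon> ((Zp p - ?B) \<inter> E)
          \<le> hausdorff_pre p s m (?B \<inter> E) + hausdorff_pre p s m ((Zp p - ?B) \<inter> E)"
        using m by (intro add_mono hausdorff_pre_antimono)
      also have "\<dots> \<le> hausdorff p s E"
        using split[OF m(4)] hausdorff_pre_le_hausdorff[OF m(1)] order_trans by blast
      finally show ?thesis .
    qed
    then have "hausdorff p s (?B \<inter> E) + hausdorff_pre p s \<epsilon> ((Zp p - ?B) \<inter> E) \<le> hausdorff p s E"
      if "0 < \<epsilon>" for \<epsilon>
      unfolding hausdorff_eq_SUP[of _ _ "?B \<inter> E"] using that
      by (subst ennreal_SUP_add_left[symmetric]) (auto intro: SUP_least)
    then show ?thesis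
      unfolding hausdorff_eq_SUP[of _ _ "(Zp p - ?B) \<inter> E"]
      by (subst ennreal_SUP_add_right) (auto intro: SUP_least)
  qed
  have "hausdorff p s E \<le> hausdorff p s (?B \<inter> E) + hausdorff p s ((Zp p - ?B) \<inter> E)"
    if "E \<subseteq> Zp p" for E
  proof -
    interpret Z: ring_of_sets "Zp p" "Pow (Zp p)" by (rule ring_of_sets_Pow)
    have "subadditive (Pow (Zp p)) (hausdorff p s)"
      using outer_measure_space_hausdorff[of p s] Z.countably_subadditive_subadditive
      by (auto simp: outer_measure_space_def)
    then have "hausdorff p s ((?B \<inter> E) \<union> ((Zp p - ?B) \<inter> E))
        \<le> hausdorff p s (?B \<inter> E) + hausdorff p s ((Zp p - ?B) \<inter> E)"
      by (rule subadditiveD) (use that in auto)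
    moreover have "(?B \<inter> E) \<union> ((Zp p - ?B) \<inter> E) = E" using that by blast
    ultimately show ?thesis by simp
  qed
  then show ?thesis
    unfolding sets_hausdorff_measure lambda_system_def
    using BZ le by (auto intro!: antisym)
qed

section \<open>Residue balls\<close>

lemma mem_residue_ball_iff:
  assumes "prime p"
  shows "y \<in> residue_ball p n a \<longleftrightarrow> y \<in> Zp p \<and> y n = a mod int p ^ n"
  unfolding residue_ball_def mem_zp_ball_iff[OF assms]
  by (simp add: zp_of_int_in_Zp[OF assms]) (simp add: zp_of_int_def)

lemma Zp_bounds: "x \<in> Zp p \<Longrightarrow> 0 \<le> x n \<and> x n < int p ^ n"
  by (simp add: Zp_def)

lemma zp_ball_eq_residue_ball:
  assumes "prime p" "x \<in> Zp p"
  shows "zp_ball p x (1 / real p ^ n) = residue_ball p n (x n)"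
  using Zp_bounds[OF assms(2), of n] assms
  by (auto simp: mem_zp_ball_iff mem_residue_ball_iff)

lemma finite_residue_classes [simp]: "finite (residue_classes p F n)"
  by (rule finite_subset[of _ "{0..<int p ^ n}"]) (auto simp: residue_classes_def)

lemma residue_class_of_point:
  assumes "prime p" "x \<in> F" "x \<in> Zp p"
  shows "x n \<in> residue_classes p F n"
  using Zp_bounds[OF assms(3), of n] assms
  by (auto simp: residue_classes_def mem_residue_ball_iff)

lemma mem_residue_ball_class_iff:
  assumes "prime p" "x \<in> Zp p" "a \<in> residue_classes p F n"
  shows "x \<in> residue_ball p n a \<longleftrightarrow> x n = a"
  using assms by (auto simp: residue_classes_def mem_residue_ball_iff)

text \<open>A point whose residue class modulo \<open>p ^ n\<close> meets \<open>F\<close> for every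
  \<open>n\<close> has points of \<open>F\<close> arbitrarily near, hence lies in \<open>F\<close>
  by closedness. Each level is a finite union of balls, which yields measurability of
  \<open>F\<close>.\<close>

lemma closed_eq_INT_residue_balls:
  assumes "prime p" "closedin (zp_topology p) F"
  shows "F = (\<Inter>n. \<Union>a\<in>residue_classes p F n. residue_ball p n a)"
proof -
  interpret Metric_space "Zp p" "zp_dist p" by (rule Metric_space_Zp[OF assms(1)])
  have FZ: "F \<subseteq> Zp p" using assms(2) closedin_metric by blast
  show ?thesis
  proof (intro equalityI subsetI)
    fix x assume x: "x \<in> F"
    then have xZ: "x \<in> Zp p" using FZ by blast
    have "x \<in> residue_ball p n (x n)" for n
      using mem_residue_ball_class_iff[OF assms(1) xZ residue_class_of_point[OF assms(1) x xZ]] by simp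
    then show "x \<in> (\<Inter>n. \<Union>a\<in>residue_classes p F n. residue_ball p n a)"
      using residue_class_of_point[OF assms(1) x xZ] by blast
  next
    fix x assume x: "x \<in> (\<Inter>n. \<Union>a\<in>residue_classes p F n. residue_ball p n a)"
    then have xZ: "x \<in> Zp p" using assms(1) by (auto simp: mem_residue_ball_iff)
    show "x \<in> F"
    proof (rule ccontr)
      assume "x \<notin> F"
      then obtain r where r: "r > 0" "disjnt F (mball x r)"
        using assms(2) xZ unfolding closedin_metric by blast
      have "1 < real p" using prime_gt_1_nat[OF assms(1)] by simp
      then obtain n where n: "(1 / real p) ^ n < r"
        using real_arch_pow_inv[OF r(1), of "1 / real p"] by auto
      obtain a where a: "a \<in> residue_classes p F n" "x \<in> residue_ball p n a" using x by blast
      then obtain y where y: "y \<in> F" "y \<in> residue_ball p n a"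
        by (auto simp: residue_classes_def)
      then have "x n = y n" using a assms(1) by (auto simp: mem_residue_ball_iff)
      then have "zp_dist p x y \<le> 1 / real p ^ n"
        using zp_dist_le_iff[OF assms(1) xZ] y(1) FZ by auto
      then have "zp_dist p x y < r" using n by (simp add: power_one_over)
      then have "y \<in> mball x r" using xZ y(1) FZ by auto
      then show False using r(2) y(1) by (auto simp: disjnt_def)
    qed
  qed
qed

lemma residue_ball_in_sets:
  "prime p \<Longrightarrow> residue_ball p n a \<in> sets (hausdorff_measure p s)"
  unfolding residue_ball_def by (rule zp_ball_in_sets)

lemma closed_in_sets:
  assumes "prime p" "closedin (zp_topology p) F"
  shows "F \<in> sets (hausdorff_measure p s)"
  by (subst closed_eq_INT_residue_balls[OF assms])
     (intro sets.countable_INT; auto intro!: sets.finite_UN residue_ball_in_sets assms)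

section \<open>Counting in intervals and the integral inequality\<close>

text \<open>Every \<open>u < limsup t\<close> is exceeded by \<open>t n\<close> for infinitely many
  \<open>n\<close>, and there \<open>u * c \<le> t n * c \<le> b n\<close>. Taking the supremum over
  \<open>u\<close> also handles \<open>c = top\<close>, while \<open>limsup t = 0\<close> is settled
  by \<open>0 * top = 0\<close>.\<close>

lemma limsup_mult_le_ennreal:
  fixes t b :: "nat \<Rightarrow> ennreal"
  assumes le: "\<And>n. t n * c \<le> b n"
  shows "limsup t * c \<le> limsup b"
proof (cases "limsup t = 0")
  case False
  then have pos: "0 < limsup t" by (simp add: zero_less_iff_neq_zero)
  have "u * c \<le> limsup b" if "u < limsup t" for u
  proof (rule ccontr)
    assume "\<not> u * c \<le> limsup b"
    then have "\<forall>\<^sub>F n in sequentially. b n < u * c" by (intro Limsup_lessD) simp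
    then have "\<forall>\<^sub>F n in sequentially. t n \<le> u"
      by eventually_elim (use le in \<open>meson linear leD mult_right_mono order_trans zero_le\<close>)
    then have "limsup t \<le> u" by (rule Limsup_bounded)
    then show False using that by simp
  qed
  moreover have "(SUP u\<in>{..<limsup t}. u * c) = limsup t * c"
    using pos by (subst SUP_mult_right_ennreal[symmetric]) (auto simp: Sup_lessThan)
  ultimately show ?thesis by (metis (mono_tags, lifting) SUP_least lessThan_iff)
qed simp

text \<open>As \<open>L\<close> grows the supremum runs over fewer intervals, so the sequence
  decreases; the \<open>lim\<close> in the definition is therefore a genuine limit.\<close>

lemma interval_limsup_tendsto:
  "(\<lambda>L::nat. Sup {f I | I. (\<exists>M N. I = {M<..N}) \<and> L \<le> card I}) \<longlonglongrightarrow> interval_limsup f"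
proof -
  let ?S = "\<lambda>L::nat. Sup {f I | I. (\<exists>M N. I = {M<..N}) \<and> L \<le> card I}"
  have "decseq ?S" unfolding decseq_def by (auto intro!: Sup_subset_mono intro: order_trans)
  then have "?S \<longlonglongrightarrow> (INF L. ?S L)" by (rule LIMSEQ_INF)
  then show ?thesis unfolding interval_limsup_def by (simp add: limI)
qed

text \<open>The class is an arithmetic progression of step \<open>m\<close>, and rounding at the two
  ends of the interval costs at most one extra point, wherever the interval lies.\<close>

lemma card_residue_class_interval_le:
  fixes m c M N :: int
  assumes "0 < m"
  shows "real (card {k \<in> {M<..N}. k mod m = c}) \<le> real (card {M<..N}) / real_of_int m + 1"
proof (cases "M \<le> N \<and> c mod m = c")
  case True
  \<comment> \<open>Elements of the class are \<open>c + m * j\<close>, and membership in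
    \<open>{M<..N}\<close> forces \<open>?a < j \<le> ?b\<close>. Counting these \<open>j\<close>
    gives the bound.\<close>
  let ?a = "(M - c) div m" and ?b = "(N - c) div m"
  have "{k \<in> {M<..N}. k mod m = c} \<subseteq> (\<lambda>j. c + m * j) ` {?a<..?b}"
  proof
    fix k assume k: "k \<in> {k \<in> {M<..N}. k mod m = c}"
    then have keq: "k = c + m * (k div m)" by (metis (mono_tags) mem_Collect_eq mod_mult_div_eq)
    have "k div m \<le> ?b"
      using zdiv_mono1[OF _ assms, of "m * (k div m)" "N - c"] k keq assms by simp
    moreover have "?a < k div m"
    proof (rule ccontr)
      assume "\<not> ?a < k div m"
      then have "m * (k div m) \<le> m * ?a" using assms by simp
      also have "\<dots> \<le> M - c"
        using mult_div_mod_eq[of m "M - c"] pos_mod_sign[OF assms, of "M - c"] by linarith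
      finally show False using k keq by auto
    qed
    ultimately show "k \<in> (\<lambda>j. c + m * j) ` {?a<..?b}" using keq by auto
  qed
  then have "card {k \<in> {M<..N}. k mod m = c} \<le> card {?a<..?b}"
    by (rule surj_card_le[rotated]) simp
  then have le: "real (card {k \<in> {M<..N}. k mod m = c}) \<le> real (nat (?b - ?a))" by simp
  have ab: "?a \<le> ?b" using True assms by (intro zdiv_mono1) auto
  have "m * ?b \<le> N - c"
    using mult_div_mod_eq[of m "N - c"] pos_mod_sign[OF assms, of "N - c"] by linarith
  moreover have "M - c < m * ?a + m"
    using mult_div_mod_eq[of m "M - c"] pos_mod_bound[OF assms, of "M - c"] by linarith
  ultimately have "m * (?b - ?a) \<le> (N - M) + m" by (simp add: algebra_simps)
  then have "real_of_int m * real_of_int (?b - ?a) \<le> real_of_int (N - M) + real_of_int m"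
    by (metis of_int_add of_int_le_iff of_int_mult)
  then have "real_of_int (?b - ?a) \<le> real_of_int (N - M) / real_of_int m + 1"
    using assms by (simp add: field_simps)
  then show ?thesis using le ab True by simp
next
  case False
  then have "{k \<in> {M<..N}. k mod m = c} = {}" by auto
  then show ?thesis using assms by (simp only: card.empty) simp
qed

section \<open>The integral of the densities at level \<open>n\<close>\<close>

lemma eta_n_cong:
  assumes "prime p" "x \<in> Zp p"
  shows "eta_n p s F x n = eta_n p s F (zp_of_int p (x n)) n"
  unfolding eta_n_def zp_ball_eq_residue_ball[OF assms]
  by (simp add: residue_ball_def)

text \<open>On \<open>F\<close> the integrand is constant on each of the finitely many residue
  classes, so it is a finite combination of indicators of measurable sets; this gives both
  measurability and the value of the integral.\<close>

lemma nn_integral_eta_n: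
  fixes s :: real
  assumes "prime p" "closedin (zp_topology p) F"
  shows "(\<lambda>x. eta_n p s F x n * indicator F x) \<in> borel_measurable (hausdorff_measure p s)" (is ?meas)
    and "(\<integral>\<^sup>+ x\<in>F. eta_n p s F x n \<partial>hausdorff_measure p s)
      = (\<Sum>a\<in>residue_classes p F n. eta_n p s F (zp_of_int p a) n * hausdorff p s (F \<inter> residue_ball p n a))"
      (is ?int)
proof -
  have FZ: "F \<subseteq> Zp p"
    using assms(2) by (simp add: Metric_space.closedin_metric[OF Metric_space_Zp[OF assms(1)]])
  have eq: "eta_n p s F x n * indicator F x
      = (\<Sum>a\<in>residue_classes p F n. eta_n p s F (zp_of_int p a) n * indicator (F \<inter> residue_ball p n a) x)" for x
  proof (cases "x \<in> F")
    case True
    then have xZ: "x \<in> Zp p" using FZ by auto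
    \<comment> \<open>Only the class \<open>a = x n\<close> contains \<open>x\<close>, so a single
      term survives.\<close>
    have "(\<Sum>a\<in>residue_classes p F n. eta_n p s F (zp_of_int p a) n * indicator (F \<inter> residue_ball p n a) x)
        = (\<Sum>a\<in>residue_classes p F n. if x n = a then eta_n p s F (zp_of_int p a) n else 0)"
      using True xZ assms(1) by (intro sum.cong) (auto simp: indicator_def mem_residue_ball_class_iff)
    then show ?thesis
      using True residue_class_of_point[OF assms(1) True xZ] eta_n_cong[OF assms(1) xZ]
      by simp
  qed simp
  have [measurable]: "F \<inter> residue_ball p n a \<in> sets (hausdorff_measure p s)" for a
    by (intro sets.Int closed_in_sets residue_ball_in_sets assms)
  show ?meas unfolding eq by measurable
  show ?int unfolding eq
    by (subst nn_integral_sum) (auto simp: nn_integral_cmult_indicator emeasure_hausdorff_measure)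
qed

section \<open>Bounding the counting measure by the densities at level \<open>n\<close>\<close>

lemma zp_ints_residue_ball:
  assumes "prime p"
  shows "zp_ints p (residue_ball p n a) = {k. k mod int p ^ n = a mod int p ^ n}"
  by (auto simp: zp_ints_def mem_residue_ball_iff[OF assms] zp_of_int_in_Zp[OF assms])
     (simp_all add: zp_of_int_def)

lemma card_zp_ints_eq_sum:
  assumes "prime p"
  shows "card (zp_ints p F \<inter> {M<..N})
    = (\<Sum>a\<in>residue_classes p F n. card (zp_ints p (F \<inter> residue_ball p n a) \<inter> {M<..N}))"
proof -
  have "zp_ints p F \<inter> {M<..N} = (\<Union>a\<in>residue_classes p F n. zp_ints p (F \<inter> residue_ball p n a) \<inter> {M<..N})"
    using residue_class_of_point[OF assms _ zp_of_int_in_Zp[OF assms]]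
      mem_residue_ball_class_iff[OF assms zp_of_int_in_Zp[OF assms]]
    by (auto simp: zp_ints_def)
  also have "card \<dots> = (\<Sum>a\<in>residue_classes p F n. card (zp_ints p (F \<inter> residue_ball p n a) \<inter> {M<..N}))"
    using mem_residue_ball_class_iff[OF assms zp_of_int_in_Zp[OF assms]]
    by (intro card_UN_disjoint) (auto simp: zp_ints_def)
  finally show ?thesis .
qed

text \<open>For intervals with at least \<open>L\<close> points, a class modulo \<open>p ^ n\<close>
  has at most \<open>(1 / p ^ n + 1 / L) * |I|\<close> points in \<open>I\<close>. Replacing
  \<open>|I|\<close> by the size of the class in the denominator thus costs a factor that tends to
  \<open>(1 / p ^ n) powr s\<close> as \<open>L\<close> grows.\<close>

lemma card_zp_ints_ratio_le:
  fixes s :: real and L :: nat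
  assumes "prime p" "0 < s" "0 < L" "L \<le> card {M<..N}"
  shows "real (card (zp_ints p F \<inter> {M<..N})) / real (card {M<..N}) powr s
    \<le> (\<Sum>a\<in>residue_classes p F n.
        (1 / real p ^ n + 1 / real L) powr s *
        (real (card (zp_ints p (F \<inter> residue_ball p n a) \<inter> {M<..N}))
          / real (card (zp_ints p (residue_ball p n a) \<inter> {M<..N})) powr s))"
    (is "_ \<le> (\<Sum>a\<in>_. ?c powr s * (?A a / ?B a powr s))")
proof -
  let ?I = "real (card {M<..N})"
  have I: "0 < ?I" using assms(3,4) by simp
  have pn: "0 < real p ^ n" using prime_gt_0_nat[OF assms(1)] by simp
  have le: "?A a / ?I powr s \<le> ?c powr s * (?A a / ?B a powr s)" for a
  proof (cases "zp_ints p (residue_ball p n a) \<inter> {M<..N} = {}")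
    \<comment> \<open>The ratio on the right is then 0 / 0, which evaluates to 0; this is harmless
      since the numerator on the left vanishes too.\<close>
    case True
    then have "zp_ints p (F \<inter> residue_ball p n a) \<inter> {M<..N} = {}" by (auto simp: zp_ints_def)
    then show ?thesis by simp
  next
    case False
    then have B: "0 < ?B a" by (simp add: card_gt_0_iff)
    have "zp_ints p (residue_ball p n a) \<inter> {M<..N} = {k\<in>{M<..N}. k mod int p ^ n = a mod int p ^ n}"
      by (auto simp: zp_ints_residue_ball[OF assms(1)])
    then have "?B a \<le> ?I / real p ^ n + 1"
      using card_residue_class_interval_le[of "int p ^ n" M N "a mod int p ^ n"] prime_gt_0_nat[OF assms(1)]
      by simp
    \<comment> \<open>The additive error 1 is absorbed into the factor, which is the origin of the
      term \<open>1 / L\<close>.\<close>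
    also have "1 \<le> ?I / real L" using assms(3,4) by simp
    then have "?I / real p ^ n + 1 \<le> ?c * ?I"
      by (simp add: distrib_right del: card_greaterThanAtMost_int)
    finally have "?B a powr s \<le> ?c powr s * ?I powr s"
      using powr_mono2[of s "?B a" "?c * ?I"] assms(2) B pn by (simp add: powr_mult del: card_greaterThanAtMost_int)
    then have "?A a * ?B a powr s \<le> ?A a * (?c powr s * ?I powr s)" by (intro mult_left_mono) auto
    moreover have "0 < ?I powr s" "0 < ?B a powr s" unfolding powr_gt_zero using I B by linarith+
    ultimately show ?thesis by (simp add: field_simps del: card_greaterThanAtMost_int)
  qed
  have "real (card (zp_ints p F \<inter> {M<..N})) / ?I powr s = (\<Sum>a\<in>residue_classes p F n. ?A a / ?I powr s)"
    unfolding card_zp_ints_eq_sum[OF assms(1), of F M N n] by (simp add: sum_divide_distrib)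
  also have "\<dots> \<le> (\<Sum>a\<in>residue_classes p F n. ?c powr s * (?A a / ?B a powr s))"
    by (intro sum_mono le)
  finally show ?thesis .
qed

text \<open>With \<open>n\<close> fixed, the bound for single intervals passes to suprema over
  intervals with at least \<open>L\<close> points. Letting \<open>L\<close> tend to infinity
  commutes with the finite sum over classes.\<close>

lemma counting_measure_le_sum_eta_n:
  fixes s :: real
  assumes "prime p" "0 < s"
  shows "counting_measure s (zp_ints p F)
    \<le> (\<Sum>a\<in>residue_classes p F n. ennreal ((1 / real p ^ n) powr s) * eta_n p s F (zp_of_int p a) n)"
proof -
  define S where "S f L = Sup {f I | I. (\<exists>M N::int. I = {M<..N}) \<and> L \<le> card I}"
    for f :: "int set \<Rightarrow> ennreal" and L :: nat
  define \<phi> where "\<phi> I = ennreal (real (card (zp_ints p F \<inter> I)) / real (card I) powr s)" for I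
  define \<psi> where "\<psi> a I = ennreal (real (card (zp_ints p (F \<inter> residue_ball p n a) \<inter> I))
          / real (card (zp_ints p (residue_ball p n a) \<inter> I)) powr s)" for a I
  define c where "c L = (1 / real p ^ n + 1 / real L) powr s" for L :: nat
  have pn: "0 < real p ^ n" using prime_gt_0_nat[OF assms(1)] by simp
  have lim: "(\<lambda>L. S f L) \<longlonglongrightarrow> interval_limsup f" for f
    unfolding S_def by (rule interval_limsup_tendsto)
  have "c \<longlonglongrightarrow> (1 / real p ^ n + 0) powr s"
    unfolding c_def using pn by (intro tendsto_intros lim_1_over_n) simp
  then have c: "(\<lambda>L. ennreal (c L)) \<longlonglongrightarrow> ennreal ((1 / real p ^ n) powr s)"
    by (intro tendsto_ennrealI) simp
  have "S \<phi> L \<le> (\<Sum>a\<in>residue_classes p F n. ennreal (c L) * S (\<psi> a) L)" if "0 < L" for L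
    unfolding S_def[of \<phi>]
  proof (rule Sup_least, clarify)
    fix M N :: int assume L: "L \<le> card {M<..N}"
    have "\<phi> {M<..N} \<le> (\<Sum>a\<in>residue_classes p F n. ennreal (c L) * \<psi> a {M<..N})"
      using ennreal_leI[OF card_zp_ints_ratio_le[OF assms \<open>0 < L\<close> L, of F n]]
      unfolding \<phi>_def \<psi>_def c_def by (simp add: ennreal_mult'[symmetric])
    also have "\<dots> \<le> (\<Sum>a\<in>residue_classes p F n. ennreal (c L) * S (\<psi> a) L)"
      unfolding S_def using L
      by (intro sum_mono mult_left_mono Sup_upper CollectI exI[of _ "{M<..N}"]) auto
    finally show "\<phi> {M<..N} \<le> (\<Sum>a\<in>residue_classes p F n. ennreal (c L) * S (\<psi> a) L)" .
  qed
  then have ev: "\<forall>\<^sub>F L in sequentially. S \<phi> L \<le> (\<Sum>a\<in>residue_classes p F n. ennreal (c L) * S (\<psi> a) L)"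
    by (intro eventually_sequentiallyI[of 1]) simp
  \<comment> \<open>The limit of \<open>c\<close> is positive and finite, so the product never takes
    the form \<open>0 * top\<close>, where multiplication in \<open>ennreal\<close> is
    discontinuous.\<close>
  have "(\<lambda>L. \<Sum>a\<in>residue_classes p F n. ennreal (c L) * S (\<psi> a) L)
      \<longlonglongrightarrow> (\<Sum>a\<in>residue_classes p F n. ennreal ((1 / real p ^ n) powr s) * interval_limsup (\<psi> a))"
    using pn by (intro tendsto_sum tendsto_mult_ennreal c lim) auto
  then have "interval_limsup \<phi>
      \<le> (\<Sum>a\<in>residue_classes p F n. ennreal ((1 / real p ^ n) powr s) * interval_limsup (\<psi> a))"
    by (rule tendsto_le[OF sequentially_bot _ lim ev])
  moreover have "counting_measure s (zp_ints p F) = interval_limsup \<phi>"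
    by (simp add: counting_measure_def \<phi>_def[abs_def])
  moreover have "eta_n p s F (zp_of_int p a) n = interval_limsup (\<psi> a)" for a
    by (simp add: eta_n_def \<psi>_def[abs_def] residue_ball_def)
  ultimately show ?thesis by simp
qed

lemma one_over_power_powr:
  assumes "prime p"
  shows "(1 / real p ^ n) powr s = real p powr (- (real n * s))"
proof -
  have "0 < real p" using prime_gt_0_nat[OF assms] by simp
  then have "1 / real p ^ n = real p powr (- real n)"
    by (simp add: powr_minus powr_realpow divide_inverse)
  then show ?thesis by (simp add: powr_powr)
qed

section \<open>Passage to the limit in \<open>n\<close>, and the regular case\<close>

lemma lower_theta_times_counting_measure_le:
  fixes p :: nat and s :: real and F :: "padic set" and g :: "padic \<Rightarrow> real"
  assumes p: "prime p" and s: "s > 0" and closed: "closedin (zp_topology p) F"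
    and int: "set_integrable (hausdorff_measure p s) F g"
    and AE: "AE x in hausdorff_measure p s. x \<in> F \<longrightarrow>
           (\<forall>n. enn2ereal (eta_n p s F x n) \<le> ereal (g x))"
  shows "lower_theta p s F * counting_measure s (zp_ints p F)
           \<le> (\<integral>\<^sup>+ x\<in>F. eta p s F x \<partial>hausdorff_measure p s)"
proof -
  let ?M = "hausdorff_measure p s"
  define t where "t n = Min ((\<lambda>a. hausdorff p s (F \<inter> residue_ball p n a)
                             / ennreal (real p powr (- (real n * s)))) ` residue_classes p F n)" for n
  have "t n * counting_measure s (zp_ints p F) \<le> (\<integral>\<^sup>+ x\<in>F. eta_n p s F x n \<partial>?M)" for n
  proof -
    let ?c = "ennreal (real p powr (- (real n * s)))"
    \<comment> \<open>A nonzero finite divisor can be multiplied back in \<open>ennreal\<close>,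
      even if the dividend is infinite.\<close>
    have c: "?c \<noteq> 0" "?c \<noteq> top" using prime_gt_0_nat[OF p] by auto
    have t: "t n * ?c \<le> hausdorff p s (F \<inter> residue_ball p n a)" if "a \<in> residue_classes p F n" for a
    proof -
      have "t n \<le> hausdorff p s (F \<inter> residue_ball p n a) / ?c"
        unfolding t_def using that by (intro Min_le) auto
      then have "t n * ?c \<le> hausdorff p s (F \<inter> residue_ball p n a) / ?c * ?c"
        by (rule mult_right_mono) simp
      then show ?thesis using c by (simp add: ennreal_divide_times ennreal_mult_divide_eq)
    qed
    have "t n * counting_measure s (zp_ints p F)
        \<le> t n * (\<Sum>a\<in>residue_classes p F n. ?c * eta_n p s F (zp_of_int p a) n)"
      using counting_measure_le_sum_eta_n[OF p s, of F n] unfolding one_over_power_powr[OF p]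
      by (intro mult_left_mono) auto
    also have "\<dots> = (\<Sum>a\<in>residue_classes p F n. eta_n p s F (zp_of_int p a) n * (t n * ?c))"
      by (simp add: sum_distrib_left mult_ac)
    also have "\<dots> \<le> (\<Sum>a\<in>residue_classes p F n.
        eta_n p s F (zp_of_int p a) n * hausdorff p s (F \<inter> residue_ball p n a))"
      by (intro sum_mono mult_left_mono t) auto
    also have "\<dots> = (\<integral>\<^sup>+ x\<in>F. eta_n p s F x n \<partial>?M)"
      by (rule nn_integral_eta_n(2)[OF p closed, symmetric])
    finally show ?thesis .
  qed
  then have "limsup t * counting_measure s (zp_ints p F)
      \<le> limsup (\<lambda>n. \<integral>\<^sup>+ x\<in>F. eta_n p s F x n \<partial>?M)"
    by (rule limsup_mult_le_ennreal)
  also have "\<dots> \<le> (\<integral>\<^sup>+ x. limsup (\<lambda>n. eta_n p s F x n * indicator F x) \<partial>?M)"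
  proof (rule nn_integral_limsup)
    \<comment> \<open>The majorant is the positive part of \<open>g\<close> on \<open>F\<close> and
      0 elsewhere, since \<open>ennreal\<close> truncates negative reals; its integral is at most
      that of the absolute value of \<open>g\<close>.\<close>
    let ?w = "\<lambda>x. ennreal (indicator F x *\<^sub>R g x)"
    show "?w \<in> borel_measurable ?M"
      using int unfolding set_integrable_def by measurable
    show "(\<integral>\<^sup>+ x. ?w x \<partial>?M) < \<infinity>"
    proof -
      have "(\<integral>\<^sup>+ x. ?w x \<partial>?M) \<le> (\<integral>\<^sup>+ x. ennreal (norm (indicator F x *\<^sub>R g x)) \<partial>?M)"
        by (intro nn_integral_mono ennreal_leI) simp
      also have "\<dots> < \<infinity>" using int unfolding set_integrable_def integrable_iff_bounded by simp
      finally show ?thesis .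
    qed
    show "AE x in ?M. eta_n p s F x n * indicator F x \<le> ?w x" for n
      using AE
    proof eventually_elim
      case (elim x)
      have "eta_n p s F x n \<le> ennreal (g x)" if "x \<in> F"
      proof -
        have "e2ennreal (enn2ereal (eta_n p s F x n)) \<le> e2ennreal (ereal (g x))"
          using elim that by (intro e2ennreal_mono) auto
        then show ?thesis by simp
      qed
      then show ?case by (auto simp: indicator_def)
    qed
  qed (rule nn_integral_eta_n(1)[OF p closed])
  also have "\<dots> = (\<integral>\<^sup>+ x\<in>F. eta p s F x \<partial>?M)"
    \<comment> \<open>On \<open>F\<close> the indicator is 1; off \<open>F\<close> the sequence is
      constantly 0, and so is its limsup.\<close>
    by (intro nn_integral_cong) (auto simp: eta_def indicator_def Limsup_const)
  finally show ?thesis unfolding lower_theta_def t_def .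
qed

text \<open>The minimum at level \<open>n\<close> is attained on a class that contains a point
  \<open>y\<close> of \<open>F\<close>. In the ultrametric that class is the ball of radius
  \<open>1 / p ^ n\<close> about \<open>y\<close>, so regularity bounds the minimum between
  \<open>1 / C\<close> and \<open>C\<close>, uniformly in \<open>n\<close>.\<close>

lemma lower_theta_regular:
  assumes p: "prime p" and ne: "F \<noteq> {}" and reg: "ahlfors_david_regular p s F"
  shows "0 < lower_theta p s F" and "lower_theta p s F < \<infinity>"
proof -
  from reg obtain C where C: "C > 0" and FC: "closedin (zp_topology p) F"
    and bd: "\<And>x r. x \<in> F \<Longrightarrow> 0 < r \<Longrightarrow> r \<le> 1 \<Longrightarrow>
        ennreal (1 / C) \<le> hausdorff p s (F \<inter> zp_ball p x r) / ennreal (r powr s) \<and>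
        hausdorff p s (F \<inter> zp_ball p x r) / ennreal (r powr s) \<le> ennreal C"
    unfolding ahlfors_david_regular_def by blast
  have FZ: "F \<subseteq> Zp p"
    using FC by (simp add: Metric_space.closedin_metric[OF Metric_space_Zp[OF p]])
  define t where "t n = Min ((\<lambda>a. hausdorff p s (F \<inter> residue_ball p n a)
                             / ennreal (real p powr (- (real n * s)))) ` residue_classes p F n)" for n
  have t: "ennreal (1 / C) \<le> t n \<and> t n \<le> ennreal C" for n
  proof -
    obtain x where "x \<in> F" using ne by blast
    \<comment> \<open>Nonemptiness makes \<open>Min\<close> an actual value of the family rather
      than an unspecified one.\<close>
    then have "residue_classes p F n \<noteq> {}" using residue_class_of_point[OF p] FZ by blast
    then have "t n \<in> (\<lambda>a. hausdorff p s (F \<inter> residue_ball p n a)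
        / ennreal (real p powr (- (real n * s)))) ` residue_classes p F n"
      unfolding t_def by (intro Min_in) auto
    then obtain a where a: "a \<in> residue_classes p F n"
      "t n = hausdorff p s (F \<inter> residue_ball p n a) / ennreal (real p powr (- (real n * s)))" by auto
    then obtain y where y: "y \<in> F" "y \<in> residue_ball p n a" by (auto simp: residue_classes_def)
    then have "y n = a" using mem_residue_ball_class_iff[OF p _ a(1)] FZ by blast
    then have "residue_ball p n a = zp_ball p y (1 / real p ^ n)"
      using zp_ball_eq_residue_ball[OF p, of y n] y(1) FZ by auto
    moreover have "0 < 1 / real p ^ n" "1 / real p ^ n \<le> 1"
      using prime_gt_0_nat[OF p] by (auto simp: field_simps)
    ultimately show ?thesis
      using bd[OF y(1), of "1 / real p ^ n"] a(2) by (simp add: one_over_power_powr[OF p])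
  qed
  have "ennreal (1 / C) \<le> limsup t"
    using t by (intro order_trans[OF Liminf_bounded Liminf_le_Limsup]) auto
  moreover have "0 < ennreal (1 / C)" using C by simp
  ultimately show "0 < lower_theta p s F" unfolding lower_theta_def t_def by (rule less_le_trans[rotated])
  have "limsup t \<le> ennreal C" using t by (intro Limsup_bounded) auto
  then show "lower_theta p s F < \<infinity>"
    unfolding lower_theta_def t_def by (rule le_less_trans) simp
qed

theorem theoremC:
  fixes p :: nat and s :: real and F :: "padic set" and g :: "padic \<Rightarrow> real"
  assumes "prime p"
    and "s > 0"
    and "F \<noteq> {}"
    and "closedin (zp_topology p) F"
    and "hausdorff p s F < \<infinity>"
    and "set_integrable (hausdorff_measure p s) F g"
    and "AE x in hausdorff_measure p s. x \<in> F \<longrightarrow>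
           (\<forall>n. enn2ereal (eta_n p s F x n) \<le> ereal (g x))"
  shows "lower_theta p s F * counting_measure s (zp_ints p F)
           \<le> (\<integral>\<^sup>+ x\<in>F. eta p s F x \<partial>hausdorff_measure p s)
         \<and> (ahlfors_david_regular p s F \<longrightarrow> 0 < lower_theta p s F \<and> lower_theta p s F < \<infinity>)"
  using lower_theta_times_counting_measure_le[OF assms(1,2,4,6,7)] lower_theta_regular[OF assms(1,3)] by blast

end
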